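(* Let $m=n-k$ for some constant $k=\Theta(1)$, with $m$ even and $2(k+1)^2\le n$, and let $\mathrm{Enc}$ be the explicit antipodal-matching encoder described in the context. Then $\mathrm{Enc}$ is correct, i.e. $\mathrm{Enc}(x)\in\mathrm{B}_{\mathrm S}(n,m;1/2)$ for all $x\in\{0,1\}^{n^2-n}$. The redundancy of $\mathrm{Enc}$ is $n$ bits.
   Context: The weight $\mathrm{wt}$ of a binary sequence or array is its number of ones. For $p\in[0,1]$ and $m\le n$, $\mathrm{B}_{\mathrm S}(n,m;p)$ is the set of all $n\times n$ binary arrays in which every $m\times m$ subarray (formed by $m$ consecutive rows and $m$ consecutive columns) has weight at most $pm^2$; thus $\mathrm{B}_{\mathrm S}(n,m;1/2)\subset\mathrm{B}_{\mathrm S}(n,m;p)$ for $p\ge1/2$. The redundancy of an encoder $\{0,1\}^\kappa\to\{0,1\}^{n\times n}$ is $n^2-\kappa$. An antipodal matching on $\{0,1\}^r$ is a map $\phi$ from $\{0,1\}^r$ to itself such that for every $u$: $\mathrm{wt}(\phi(u))=r-\mathrm{wt}(u)$; if $\mathrm{wt}(u)>r/2$ then $\phi(u)$ has all its ones in positions where $u$ has ones; and $\phi(\phi(u))=u$. Let $\phi_1$ be an antipodal matching on $\{0,1\}^{m^2}$ and $\phi_2$ one on $\{0,1\}^{m^2-m}$; they are applied to arrays of size $m\times m$ and $(m-1)\times m$ respectively, regarded as sequences. The encoder $\mathrm{Enc}$, on input $x\in\{0,1\}^{n^2-n}$: (I) Fill the bits of $x$ row by row into the first $n-1$ rows of an $n\times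 n$ array $A$; denote the last row by $A_n=y_1y_2\ldots y_n$, to be determined. (II) Order the $(k+1)^2$ subarrays of $A$ of size $m\times m$ row by row as $B_1,\ldots,B_{(k+1)^2}$ (so exactly the last $k+1$ of them meet the last row of $A$). (III) For $1\le i\le k(k+1)$ in turn: if $\mathrm{wt}(B_i)>m^2/2$, set $y_{2i-1}=1$ and replace $B_i$ by $\phi_1(B_i)$; otherwise $y_{2i-1}=0$. (IV) For $k(k+1)+1\le i\le(k+1)^2$ in turn, let $C_i$ be the $(m-1)\times m$ subarray obtained by removing the last row of $B_i$: if $\mathrm{wt}(C_i)>(m^2-m)/2$, set $y_{2i-1}=1$ and replace $C_i$ by $\phi_2(C_i)$; otherwise $y_{2i-1}=0$. (V) Set $y_{2i}=\overline{y_{2i-1}}$ (the complementary bit) for $1\le i\le(k+1)^2$, and fill the remaining bits of the last row with $0$. (VI) Output $A$.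
   Formalization: Correctness of Enc is stated under 2(k+1)^2 ≤ m instead of only 2(k+1)^2 ≤ n, since it fails otherwise (e.g. k=2, n=18, m=16 for a suitable matching φ_2); the redundancy claim keeps 2(k+1)^2 ≤ n. *)

theory Defs
  imports "Jordan_Normal_Form.Matrix"
begin

text \<open>
  Binary sequences of length r are Boolean lists of length r, and binary \<open>n \<times> n\<close> arrays are
  Boolean matrices in \<open>carrier_mat n n\<close>, with True for 1.  All indices start at 0.
\<close>

definition bitseqs :: "nat \<Rightarrow> bool list set" where
  "bitseqs r = {u. length u = r}"

definition wt :: "bool list \<Rightarrow> nat" where
  "wt u = count_list u True"

definition array_wt :: "bool mat \<Rightarrow> nat" where
  "array_wt M = card {(i, j). i < dim_row M \<and> j < dim_col M \<and> M $$ (i, j)}"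

text \<open>The h by w subarray of consecutive rows and columns with top-left cell (r, c).\<close>

definition subarray :: "nat \<Rightarrow> nat \<Rightarrow> nat \<Rightarrow> nat \<Rightarrow> bool mat \<Rightarrow> bool mat" where
  "subarray r c h w A = mat h w (\<lambda>(i, j). A $$ (r + i, c + j))"

definition BS :: "nat \<Rightarrow> nat \<Rightarrow> real \<Rightarrow> bool mat set" where
  "BS n m p = {A \<in> carrier_mat n n. \<forall>r c. r + m \<le> n \<longrightarrow> c + m \<le> n \<longrightarrow>
     real (array_wt (subarray r c m m A)) \<le> p * real (m^2)}"

definition antipodal_matching :: "nat \<Rightarrow> (bool list \<Rightarrow> bool list) \<Rightarrow> bool" where
  "antipodal_matching r \<phi> \<longleftrightarrow> \<phi> \<in> bitseqs r \<rightarrow> bitseqs r \<and>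
     (\<forall>u \<in> bitseqs r.
        wt (\<phi> u) = r - wt u \<and>
        (real (wt u) > real r / 2 \<longrightarrow> (\<forall>i < r. \<phi> u ! i \<longrightarrow> u ! i)) \<and>
        \<phi> (\<phi> u) = u)"

text \<open>Arrays are regarded as sequences by reading them row by row.\<close>

definition array_to_seq :: "bool mat \<Rightarrow> bool list" where
  "array_to_seq M =
     map (\<lambda>l. M $$ (l div dim_col M, l mod dim_col M)) [0..<dim_row M * dim_col M]"

definition seq_to_array :: "nat \<Rightarrow> nat \<Rightarrow> bool list \<Rightarrow> bool mat" where
  "seq_to_array h w u = mat h w (\<lambda>(i, j). u ! (i * w + j))"

definition replace_subarray :: "nat \<Rightarrow> nat \<Rightarrow> bool mat \<Rightarrow> bool mat \<Rightarrow> bool mat" where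
  "replace_subarray r c M A = mat (dim_row A) (dim_col A) (\<lambda>(i, j).
     if r \<le> i \<and> i < r + dim_row M \<and> c \<le> j \<and> j < c + dim_col M
     then M $$ (i - r, j - c) else A $$ (i, j))"

definition set_bit_last_row :: "nat \<Rightarrow> bool \<Rightarrow> bool mat \<Rightarrow> bool mat" where
  "set_bit_last_row l b A = mat (dim_row A) (dim_col A) (\<lambda>(i, j).
     if i = dim_row A - 1 \<and> j = l then b else A $$ (i, j))"

text \<open>The last row is provisionally 0; each of its bits is assigned later.\<close>

definition fill_rows :: "nat \<Rightarrow> bool list \<Rightarrow> bool mat" where
  "fill_rows n x = mat n n (\<lambda>(i, j). if i < n - 1 then x ! (i * n + j) else False)"

text \<open>
  In row-by-row order, the \<open>t\<close>-th (from 0) of the \<open>(k+1)\<^sup>2\<close> square subarrays has top-left cell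
  \<open>(t div (k+1), t mod (k+1))\<close>.  One step acts on the h by w subarray with this top-left cell:
  for \<open>h = m\<close> this is the square subarray itself, for \<open>h = m - 1\<close> the square subarray without its
  last row.  Its flag, \<open>y\<^bsub>2i-1\<^esub>\<close> for \<open>i = t + 1\<close> counted from 1, is in column \<open>2 * t\<close> of the last row.
\<close>

definition enc_step ::
    "nat \<Rightarrow> nat \<Rightarrow> nat \<Rightarrow> (bool list \<Rightarrow> bool list) \<Rightarrow> nat \<Rightarrow> bool mat \<Rightarrow> bool mat" where
  "enc_step k h w \<phi> t A =
     (let r = t div (k + 1); c = t mod (k + 1); B = subarray r c h w A in
      if real (array_wt B) > real (h * w) / 2
      then set_bit_last_row (2 * t) True
             (replace_subarray r c (seq_to_array h w (\<phi> (array_to_seq B))) A)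
      else set_bit_last_row (2 * t) False A)"

definition complete_last_row :: "nat \<Rightarrow> bool mat \<Rightarrow> bool mat" where
  "complete_last_row k A = mat (dim_row A) (dim_col A) (\<lambda>(i, j).
     if i = dim_row A - 1 then
       (if j < 2 * (k + 1)^2 then (if even j then A $$ (i, j) else \<not> A $$ (i, j - 1))
        else False)
     else A $$ (i, j))"

definition Enc ::
    "nat \<Rightarrow> nat \<Rightarrow> (bool list \<Rightarrow> bool list) \<Rightarrow> (bool list \<Rightarrow> bool list) \<Rightarrow> bool list \<Rightarrow> bool mat"
  where
  "Enc n k \<phi>1 \<phi>2 x =
     (let m = n - k;
          A1 = fill_rows n x;
          A3 = fold (enc_step k m m \<phi>1) [0..<k * (k + 1)] A1;
          A4 = fold (enc_step k (m - 1) m \<phi>2) [k * (k + 1)..<(k + 1)^2] A3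
      in complete_last_row k A4)"

text \<open>
  \<open>E\<close>, as a map from binary sequences of length \<open>\<kappa>\<close> to binary \<open>n \<times> n\<close> arrays, has redundancy
  \<open>n\<^sup>2 - \<kappa> = \<rho>\<close>.  The input length is a parameter because it cannot be read off a total function.
\<close>

definition has_redundancy :: "nat \<Rightarrow> nat \<Rightarrow> (bool list \<Rightarrow> bool mat) \<Rightarrow> int \<Rightarrow> bool" where
  "has_redundancy \<kappa> n E \<rho> \<longleftrightarrow>
     E \<in> bitseqs \<kappa> \<rightarrow> carrier_mat n n \<and> int (n^2) - int \<kappa> = \<rho>"

end

theory Submission
  imports Defs
begin

text \<open>
  Every replacement only turns ones into zeros, and it acts on the first \<open>n - 1\<close> rows.  So a
  subarray of these rows that has been balanced stays balanced, which settles the \<open>m \<times> m\<close>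
  subarrays that avoid the last row.  The other ones have at most \<open>(m\<^sup>2 - m) / 2\<close> ones above the last
  row, and the last row has exactly one \<open>1\<close> in each of its \<open>(k+1)\<^sup>2 \<le> m / 2\<close> complementary pairs.
\<close>

section \<open>Weights and the row-by-row reading of arrays\<close>

lemma wt_eq_card: "wt u = card {i. i < length u \<and> u ! i}"
  unfolding wt_def count_list_eq_length_filter length_filter_conv_card by simp

lemma array_wt_subarray:
  "array_wt (subarray r c h w A) = card {(i, j). i < h \<and> j < w \<and> A $$ (r + i, c + j)}"
  unfolding array_wt_def subarray_def by (rule arg_cong[where f = card]) auto

lemma row_major_less:
  fixes i j h w :: nat
  assumes "i < h" "j < w"
  shows "i * w + j < h * w"
proof -
  have "i * w + j < (i + 1) * w" using assms by simp
  also have "\<dots> \<le> h * w" by (rule mult_right_mono) (use assms in auto)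
  finally show ?thesis .
qed

text \<open>Division with remainder by \<open>w\<close> matches the positions of \<open>u\<close>
  with the cells of the array.\<close>

lemma array_wt_seq_to_array:
  assumes "length u = h * w"
  shows "array_wt (seq_to_array h w u) = wt u"
proof -
  have "bij_betw (\<lambda>(i, j). i * w + j) {(i, j). i < h \<and> j < w \<and> u ! (i * w + j)}
      {l. l < h * w \<and> u ! l}"
  proof (rule bij_betw_byWitness[where f' = "\<lambda>l. (l div w, l mod w)"])
    have "i * w + j < h * w" if "i < h" "j < w" for i j
      using that by (rule row_major_less)
    then show "(\<lambda>(i, j). i * w + j) ` {(i, j). i < h \<and> j < w \<and> u ! (i * w + j)}
        \<subseteq> {l. l < h * w \<and> u ! l}"
      by auto
    show "(\<lambda>l. (l div w, l mod w)) ` {l. l < h * w \<and> u ! l}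
        \<subseteq> {(i, j). i < h \<and> j < w \<and> u ! (i * w + j)}"
      \<comment> \<open>The bound \<open>l mod w < w\<close> requires \<open>w > 0\<close>, which
        holds because \<open>l < h * w\<close>.\<close>
      by (auto simp: less_mult_imp_div_less) (metis gr0I less_nat_zero_code mod_less_divisor mult_0_right)
  qed auto
  from bij_betw_same_card[OF this] show ?thesis
    unfolding wt_eq_card array_wt_def assms seq_to_array_def
    by (smt (verit) Collect_cong case_prodE case_prodI2 dim_col_mat(1) dim_row_mat(1)
        index_mat(1) old.prod.case)
qed

lemma length_array_to_seq [simp]: "length (array_to_seq M) = dim_row M * dim_col M"
  by (simp add: array_to_seq_def)

lemma array_to_seq_nth:
  assumes "i < dim_row M" "j < dim_col M"
  shows "array_to_seq M ! (i * dim_col M + j) = M $$ (i, j)"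
proof -
  have "i * dim_col M + j < dim_row M * dim_col M"
    using assms by (rule row_major_less)
  then show ?thesis
    using assms by (simp add: array_to_seq_def)
qed

lemma seq_to_array_array_to_seq: "seq_to_array (dim_row M) (dim_col M) (array_to_seq M) = M"
  by (rule eq_matI) (auto simp: seq_to_array_def array_to_seq_nth)

lemma wt_array_to_seq: "wt (array_to_seq M) = array_wt M"
  using array_wt_seq_to_array[of "array_to_seq M" "dim_row M" "dim_col M"]
  by (simp add: seq_to_array_array_to_seq)

section \<open>Deleting ones above the last row\<close>

text \<open>The last row is left unconstrained, because it holds the flags.\<close>

definition ones_below :: "nat \<Rightarrow> bool mat \<Rightarrow> bool mat \<Rightarrow> bool" where
  "ones_below n A' A \<longleftrightarrow> A' \<in> carrier_mat n n \<and>
     (\<forall>i j. i < n - 1 \<longrightarrow> j < n \<longrightarrow> A' $$ (i, j) \<longrightarrow> A $$ (i, j))"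

text \<open>The bound \<open>r + h \<le> n - 1\<close> keeps the subarray off the last row, about
  which \<open>ones_below\<close> says nothing.\<close>

lemma array_wt_subarray_mono:
  assumes "ones_below n A' A" "r + h \<le> n - 1" "c + w \<le> n"
  shows "array_wt (subarray r c h w A') \<le> array_wt (subarray r c h w A)"
  unfolding array_wt_subarray
proof (rule card_mono)
  show "finite {(i, j). i < h \<and> j < w \<and> A $$ (r + i, c + j)}"
    by (rule finite_subset[of _ "{..<h} \<times> {..<w}"]) auto
qed (use assms in \<open>auto simp: ones_below_def\<close>)

section \<open>One step of the encoder and its iteration\<close>

lemma enc_step_carrier:
  assumes "A \<in> carrier_mat n n"
  shows "enc_step k h w \<phi> t A \<in> carrier_mat n n"
  using assms
  by (auto simp: enc_step_def Let_def set_bit_last_row_def replace_subarray_def)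

lemma fold_enc_step_carrier:
  assumes "A \<in> carrier_mat n n"
  shows "fold (enc_step k h w \<phi>) ts A \<in> carrier_mat n n"
  using assms by (induction ts arbitrary: A) (auto intro: enc_step_carrier)

text \<open>A heavy block turns into one of complementary weight, hence a light one, with ones only
  where there were ones before; a light block is kept. The block ends above row
  \<open>n - 1\<close>, so writing the flag does not disturb it.\<close>

lemma enc_step_balances:
  assumes A: "A \<in> carrier_mat n n" and \<phi>: "antipodal_matching (h * w) \<phi>"
    and r: "t div (k + 1) + h \<le> n - 1" and c: "t mod (k + 1) + w \<le> n"
  shows "ones_below n (enc_step k h w \<phi> t A) A"
    and "real (array_wt (subarray (t div (k + 1)) (t mod (k + 1)) h w (enc_step k h w \<phi> t A)))
           \<le> real (h * w) / 2"
proof -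
  define r' c' where rc: "r' = t div (k + 1)" "c' = t mod (k + 1)"
  define B where "B = subarray r' c' h w A"
  define u where "u = array_to_seq B"
  have dimB [simp]: "dim_row B = h" "dim_col B = w"
    by (simp_all add: B_def subarray_def)
  have u: "u \<in> bitseqs (h * w)"
    by (simp add: u_def bitseqs_def)
  have \<phi>u: "length (\<phi> u) = h * w" "wt (\<phi> u) = h * w - wt u"
    using \<phi> u unfolding antipodal_matching_def bitseqs_def by auto
  have dimA: "dim_row A = n" "dim_col A = n"
    using A by auto
  have r': "r' + h \<le> n - 1" and c': "c' + w \<le> n"
    using r c by (simp_all only: rc)
  have "ones_below n (enc_step k h w \<phi> t A) A \<and>
      real (array_wt (subarray r' c' h w (enc_step k h w \<phi> t A))) \<le> real (h * w) / 2"
  proof (cases "real (array_wt B) > real (h * w) / 2")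
    case True
    then have heavy: "real (wt u) > real (h * w) / 2"
      by (simp add: u_def wt_array_to_seq)
    \<comment> \<open>The matching gives containment of ones only for a heavy \<open>u\<close>;
      reading positions as cells carries it over to \<open>A\<close>.\<close>
    have sub: "\<phi> u ! (i * w + j) \<Longrightarrow> A $$ (r' + i, c' + j)" if "i < h" "j < w" for i j
    proof -
      assume one: "\<phi> u ! (i * w + j)"
      have "i * w + j < h * w"
        using that by (rule row_major_less)
      with one \<phi> u heavy have "u ! (i * w + j)"
        unfolding antipodal_matching_def by blast
      then have "B $$ (i, j)"
        using array_to_seq_nth[of i B j] that by (simp add: u_def)
      then show ?thesis
        using that by (simp add: B_def subarray_def)
    qed
    have step: "enc_step k h w \<phi> t A = set_bit_last_row (2 * t) True
        (replace_subarray r' c' (seq_to_array h w (\<phi> u)) A)"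
      using True unfolding enc_step_def Let_def rc B_def u_def by simp
    have below: "ones_below n (enc_step k h w \<phi> t A) A"
      unfolding ones_below_def
    proof (intro conjI allI impI)
      fix i j
      assume ij: "i < n - 1" "j < n" and one: "enc_step k h w \<phi> t A $$ (i, j)"
      show "A $$ (i, j)"
      proof (cases "r' \<le> i \<and> i < r' + h \<and> c' \<le> j \<and> j < c' + w")
        case inside: True
        then have "\<phi> u ! ((i - r') * w + (j - c'))"
          using one ij dimA unfolding step
          by (auto simp: set_bit_last_row_def replace_subarray_def seq_to_array_def)
        then show ?thesis
          using sub[of "i - r'" "j - c'"] inside by auto
      next
        case False
        then show ?thesis
          using one ij dimA unfolding step
          by (auto simp: set_bit_last_row_def replace_subarray_def seq_to_array_def)
      qed
    qed (rule enc_step_carrier[OF A])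
    \<comment> \<open>By \<open>r'\<close> the flag lies below the block, so exactly the new block
      is read back.\<close>
    have "subarray r' c' h w (enc_step k h w \<phi> t A) = seq_to_array h w (\<phi> u)"
      unfolding step using dimA r' c'
      by (intro eq_matI)
         (auto simp: set_bit_last_row_def replace_subarray_def seq_to_array_def subarray_def)
    then have "array_wt (subarray r' c' h w (enc_step k h w \<phi> t A)) = h * w - wt u"
      using \<phi>u by (simp add: array_wt_seq_to_array)
    then have "real (array_wt (subarray r' c' h w (enc_step k h w \<phi> t A))) \<le> real (h * w) / 2"
      using heavy by linarith
    with below show ?thesis by blast
  next
    case False
    then have step: "enc_step k h w \<phi> t A = set_bit_last_row (2 * t) False A"
      unfolding enc_step_def Let_def rc B_def by simp
    have below: "ones_below n (enc_step k h w \<phi> t A) A"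
      unfolding ones_below_def step using dimA by (auto simp: set_bit_last_row_def)
    \<comment> \<open>Only the flag has changed, so monotonicity bounds the new weight by that of
      the light \<open>B\<close>.\<close>
    from array_wt_subarray_mono[OF this r' c'] False below show ?thesis
      unfolding B_def by linarith
  qed
  then show "ones_below n (enc_step k h w \<phi> t A) A"
    and "real (array_wt (subarray (t div (k + 1)) (t mod (k + 1)) h w (enc_step k h w \<phi> t A)))
           \<le> real (h * w) / 2"
    unfolding rc by blast+
qed

lemma ones_below_trans:
  "ones_below n A'' A' \<Longrightarrow> ones_below n A' A \<Longrightarrow> ones_below n A'' A"
  unfolding ones_below_def by blast

text \<open>The index list is arbitrary and \<open>h\<close> is free, so both phases of the encoder
  are instances, with \<open>h = m\<close> and \<open>h = m - 1\<close>.\<close>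

lemma fold_enc_step_balances:
  assumes "A \<in> carrier_mat n n" and "antipodal_matching (h * w) \<phi>"
    and "\<forall>t \<in> set ts. t div (k + 1) + h \<le> n - 1 \<and> t mod (k + 1) + w \<le> n"
  shows "ones_below n (fold (enc_step k h w \<phi>) ts A) A \<and>
    (\<forall>t \<in> set ts. real (array_wt (subarray (t div (k + 1)) (t mod (k + 1)) h w
       (fold (enc_step k h w \<phi>) ts A))) \<le> real (h * w) / 2)"
  using assms
proof (induction ts arbitrary: A)
  case Nil
  then show ?case by (simp add: ones_below_def)
next
  case (Cons t ts)
  define A' where "A' = enc_step k h w \<phi> t A"
  have rc: "t div (k + 1) + h \<le> n - 1" "t mod (k + 1) + w \<le> n"
    using Cons.prems by simp_all
  have A': "A' \<in> carrier_mat n n"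
    unfolding A'_def by (rule enc_step_carrier[OF Cons.prems(1)])
  note step = enc_step_balances[OF Cons.prems(1,2) rc, folded A'_def]
  have IH: "ones_below n (fold (enc_step k h w \<phi>) ts A') A' \<and>
    (\<forall>t \<in> set ts. real (array_wt (subarray (t div (k + 1)) (t mod (k + 1)) h w
       (fold (enc_step k h w \<phi>) ts A'))) \<le> real (h * w) / 2)"
    using Cons.IH[OF A' Cons.prems(2)] Cons.prems(3) by simp
  \<comment> \<open>Later blocks may overlap this one, but the remaining steps only delete ones
    above the last row, so the balance reached by step \<open>t\<close> survives.\<close>
  have "real (array_wt (subarray (t div (k + 1)) (t mod (k + 1)) h w
      (fold (enc_step k h w \<phi>) ts A'))) \<le> real (h * w) / 2"
    using array_wt_subarray_mono[OF conjunct1[OF IH] rc] step(2) by linarith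
  moreover have "fold (enc_step k h w \<phi>) (t # ts) A = fold (enc_step k h w \<phi>) ts A'"
    by (simp add: A'_def)
  ultimately show ?case
    using IH ones_below_trans[OF conjunct1[OF IH] step(1)] by simp
qed

section \<open>The completed last row\<close>

lemma complete_last_row_carrier:
  "A \<in> carrier_mat n n \<Longrightarrow> complete_last_row k A \<in> carrier_mat n n"
  by (auto simp: complete_last_row_def)

lemma ones_below_complete_last_row:
  "A \<in> carrier_mat n n \<Longrightarrow> ones_below n (complete_last_row k A) A"
  by (auto simp: complete_last_row_def ones_below_def)

text \<open>Halving the position is injective on the ones, since no pair contains two of
  them.\<close>

lemma card_ones_of_complementary_pairs:
  fixes f :: "nat \<Rightarrow> bool"
  assumes pair: "\<And>t. t < N \<Longrightarrow> f (2 * t + 1) \<longleftrightarrow> \<not> f (2 * t)"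
  shows "card {j. j < 2 * N \<and> f j} \<le> N"
proof -
  have "card {j. j < 2 * N \<and> f j} \<le> card {..<N}"
  proof (rule card_inj_on_le[where f = "\<lambda>j. j div 2"])
    show "inj_on (\<lambda>j. j div 2) {j. j < 2 * N \<and> f j}"
    proof (rule inj_onI)
      fix i j
      assume i: "i \<in> {j. j < 2 * N \<and> f j}" and j: "j \<in> {j. j < 2 * N \<and> f j}"
        and eq: "i div 2 = j div 2"
      have "i div 2 < N" using i by auto
      note p = pair[OF this]
      have "i = 2 * (i div 2) \<or> i = 2 * (i div 2) + 1" by presburger
      moreover have "j = 2 * (i div 2) \<or> j = 2 * (i div 2) + 1"
        unfolding eq by presburger
      ultimately show "i = j" using p i j by (metis mem_Collect_eq)
    qed
  qed auto
  then show ?thesis by simp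
qed

text \<open>The bound holds for any flags in \<open>A\<close>: the pairs all fit into the row by
  \<open>n\<close>, and the columns after them are 0.\<close>

lemma card_ones_complete_last_row:
  assumes A: "A \<in> carrier_mat n n" and n: "2 * (k + 1)^2 \<le> n" and "c + w \<le> n"
  shows "card {j. j < w \<and> complete_last_row k A $$ (n - 1, c + j)} \<le> (k + 1)^2"
proof -
  define f where "f j = complete_last_row k A $$ (n - 1, j)" for j
  have "n > 0" using n by (cases n) auto
  then have f: "f j \<longleftrightarrow> j < 2 * (k + 1)^2 \<and>
      (if even j then A $$ (n - 1, j) else \<not> A $$ (n - 1, j - 1))" if "j < n" for j
    using A that by (auto simp: f_def complete_last_row_def)
  \<comment> \<open>The window may cut through a pair, so its ones are counted among those of the
    whole range of pairs.\<close>
  have "card {j. j < w \<and> f (c + j)} \<le> card {j. j < 2 * (k + 1)^2 \<and> f j}"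
    by (rule card_inj_on_le[where f = "\<lambda>j. c + j"]) (use f assms(3) in auto)
  also have "\<dots> \<le> (k + 1)^2"
    by (rule card_ones_of_complementary_pairs) (use f n in auto)
  finally show ?thesis by (simp only: f_def)
qed

text \<open>Separates the rows controlled by balancing from the row controlled by the complementary
  pairs.\<close>

lemma array_wt_subarray_split_last_row:
  "array_wt (subarray r c (Suc h) w A) =
     array_wt (subarray r c h w A) + card {j. j < w \<and> A $$ (r + h, c + j)}"
proof -
  let ?top = "{(i, j). i < h \<and> j < w \<and> A $$ (r + i, c + j)}"
  let ?last = "Pair h ` {j. j < w \<and> A $$ (r + h, c + j)}"
  have "{(i, j). i < Suc h \<and> j < w \<and> A $$ (r + i, c + j)} = ?top \<union> ?last"
    by (auto simp: less_Suc_eq)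
  moreover have "card (?top \<union> ?last) = card ?top + card ?last"
  proof (rule card_Un_disjoint)
    show "finite ?top"
      by (rule finite_subset[of _ "{..<h} \<times> {..<w}"]) auto
  qed auto
  moreover have "card ?last = card {j. j < w \<and> A $$ (r + h, c + j)}"
    by (rule card_image) (auto simp: inj_on_def)
  ultimately show ?thesis
    unfolding array_wt_subarray by simp
qed

section \<open>Correctness and redundancy of the encoder\<close>

lemma Enc_carrier: "Enc n k \<phi>1 \<phi>2 x \<in> carrier_mat n n"
  unfolding Enc_def Let_def
  by (intro complete_last_row_carrier fold_enc_step_carrier) (simp add: fill_rows_def)

text \<open>A top-left cell \<open>(r, c)\<close> has \<open>r, c \<le> k\<close>. For
  \<open>r < k\<close> the first phase balances the subarray. For \<open>r = k\<close> the second
  phase leaves room for \<open>m / 2\<close> ones in the last row, and \<open>m_ge\<close> says that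
  its \<open>(k + 1)^2\<close> ones fit.\<close>

lemma Enc_in_BS:
  assumes m: "m = n - k" and n: "2 * (k + 1)^2 \<le> n" and m_ge: "2 * (k + 1)^2 \<le> m"
    and \<phi>1: "antipodal_matching (m^2) \<phi>1" and \<phi>2: "antipodal_matching (m^2 - m) \<phi>2"
  shows "Enc n k \<phi>1 \<phi>2 x \<in> BS n m (1/2)"
proof -
  have m_pos: "m > 0" using m_ge by (cases m) auto
  then have n_eq: "n = m + k" using m by simp
  have sq: "(k + 1)^2 = k * (k + 1) + (k + 1)"
    by (simp add: power2_eq_square algebra_simps)
  define A1 where "A1 = fill_rows n x"
  define A3 where "A3 = fold (enc_step k m m \<phi>1) [0..<k * (k + 1)] A1"
  define A4 where "A4 = fold (enc_step k (m - 1) m \<phi>2) [k * (k + 1)..<(k + 1)^2] A3"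
  define A where "A = complete_last_row k A4"
  have A: "Enc n k \<phi>1 \<phi>2 x = A"
    unfolding Enc_def Let_def A_def A4_def A3_def A1_def m ..
  have car: "A1 \<in> carrier_mat n n" "A3 \<in> carrier_mat n n" "A4 \<in> carrier_mat n n"
    unfolding A4_def A3_def by (auto intro!: fold_enc_step_carrier simp: A1_def fill_rows_def)
  have col: "t mod (k + 1) + m \<le> n" for t
    using mod_less_divisor[of "k + 1" t] n_eq by linarith
  \<comment> \<open>First-phase subarrays start above row \<open>k\<close> and so miss the last row;
    second-phase ones start in row at most \<open>k\<close> and miss it because one row is
    removed.\<close>
  have row3: "t div (k + 1) + m \<le> n - 1" if "t < k * (k + 1)" for t
    using less_mult_imp_div_less[OF that] n_eq by linarith
  have row4: "t div (k + 1) + (m - 1) \<le> n - 1" if "t < (k + 1)^2" for t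
    using less_mult_imp_div_less[of t "k + 1" "k + 1"] that n_eq m_pos
    by (simp add: power2_eq_square)
  have "antipodal_matching (m * m) \<phi>1"
    using \<phi>1 by (simp add: power2_eq_square)
  from fold_enc_step_balances[OF car(1) this, of "[0..<k * (k + 1)]" k, folded A3_def] row3 col
  have bal3: "real (array_wt (subarray (t div (k + 1)) (t mod (k + 1)) m m A3)) \<le> real (m * m) / 2"
    if "t < k * (k + 1)" for t
    using that by auto
  have "antipodal_matching ((m - 1) * m) \<phi>2"
    using \<phi>2 by (simp add: power2_eq_square algebra_simps)
  from fold_enc_step_balances[OF car(2) this, of "[k * (k + 1)..<(k + 1)^2]" k, folded A4_def] row4 col
  have below4: "ones_below n A4 A3"
    and bal4: "\<And>t. k * (k + 1) \<le> t \<Longrightarrow> t < (k + 1)^2 \<Longrightarrow>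
      real (array_wt (subarray (t div (k + 1)) (t mod (k + 1)) (m - 1) m A4))
        \<le> real ((m - 1) * m) / 2"
    by auto
  have belowA4: "ones_below n A A4"
    unfolding A_def by (rule ones_below_complete_last_row[OF car(3)])
  \<comment> \<open>The balance of the first phase is known for \<open>A3\<close>; the second phase
    and the completion of the last row must not destroy it.\<close>
  have belowA3: "ones_below n A A3"
    by (rule ones_below_trans[OF belowA4 below4])
  have "real (array_wt (subarray r c m m A)) \<le> 1 / 2 * real (m^2)"
    if r: "r + m \<le> n" and c: "c + m \<le> n" for r c
  proof -
    have ck: "c < k + 1" using c n_eq by simp
    \<comment> \<open>The row-by-row number of the subarray at \<open>(r, c)\<close>;
      \<open>c < k + 1\<close> lets division recover both coordinates.\<close>
    define t where "t = r * (k + 1) + c"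
    have t: "t div (k + 1) = r" "t mod (k + 1) = c"
      unfolding t_def using ck
      by (metis add.commute div_less div_mult_self1 gr_implies_not0 add_0_right, metis mod_less mod_mult_self3)
    show ?thesis
    proof (cases "r < k")
      case True
      then have "(r + 1) * (k + 1) \<le> k * (k + 1)"
        by (intro mult_right_mono) auto
      then have "t < k * (k + 1)"
        using ck by (simp add: t_def)
      from bal3[OF this] have "real (array_wt (subarray r c m m A3)) \<le> real (m * m) / 2"
        by (simp only: t)
      moreover have "array_wt (subarray r c m m A) \<le> array_wt (subarray r c m m A3)"
        by (rule array_wt_subarray_mono[OF belowA3 _ c]) (use True n_eq in simp)
      ultimately show ?thesis
        by (simp add: power2_eq_square)
    next
      case False
      then have rk: "r = k" using r n_eq by simp
      have "k * (k + 1) \<le> t" "t < (k + 1)^2"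
        using ck unfolding t_def rk sq by simp_all
      from bal4[OF this]
      have "real (array_wt (subarray r c (m - 1) m A4)) \<le> real ((m - 1) * m) / 2"
        by (simp only: t)
      moreover have "array_wt (subarray r c (m - 1) m A) \<le> array_wt (subarray r c (m - 1) m A4)"
        by (rule array_wt_subarray_mono[OF belowA4 _ c]) (use rk n_eq m_pos in simp)
      moreover have "card {j. j < m \<and> A $$ (r + (m - 1), c + j)} \<le> (k + 1)^2"
      proof -
        have "r + (m - 1) = n - 1" using rk n_eq m_pos by simp
        then show ?thesis
          using card_ones_complete_last_row[OF car(3) n c] by (simp only: A_def)
      qed
      moreover have "array_wt (subarray r c m m A) = array_wt (subarray r c (m - 1) m A) +
          card {j. j < m \<and> A $$ (r + (m - 1), c + j)}"
        using array_wt_subarray_split_last_row[of r c "m - 1" m A] m_pos by simp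
      \<comment> \<open>After doubling, the last row contributes at most
        \<open>2 * (k + 1)^2 \<le> m\<close>, which is exactly the gap between
        \<open>(m - 1) * m\<close> and \<open>m^2\<close>.\<close>
      ultimately have "2 * real (array_wt (subarray r c m m A))
          \<le> real ((m - 1) * m) + real m"
        using m_ge by linarith
      also have "\<dots> = real (m^2)"
        using m_pos by (cases m) (simp_all add: power2_eq_square algebra_simps)
      finally show ?thesis by simp
    qed
  qed
  then show ?thesis
    using Enc_carrier[of n k \<phi>1 \<phi>2 x] unfolding BS_def A by simp
qed

text \<open>For constant \<open>k\<close>, the condition \<open>2 * (k + 1)^2 \<le> m\<close>
  expresses that \<open>n\<close> is large enough, namely
  \<open>n \<ge> 2 * (k + 1)^2 + k\<close>.\<close>

theorem theorem7:
  fixes n m k :: nat and \<phi>1 \<phi>2 :: "bool list \<Rightarrow> bool list"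
  assumes "m = n - k" and "even m" and "2 * (k + 1)^2 \<le> n"
    and "antipodal_matching (m^2) \<phi>1" and "antipodal_matching (m^2 - m) \<phi>2"
  shows "(2 * (k + 1)^2 \<le> m \<longrightarrow>
            (\<forall>x \<in> bitseqs (n^2 - n). Enc n k \<phi>1 \<phi>2 x \<in> BS n m (1/2))) \<and>
         has_redundancy (n^2 - n) n (Enc n k \<phi>1 \<phi>2) (int n)"
proof
  show "2 * (k + 1)^2 \<le> m \<longrightarrow>
      (\<forall>x \<in> bitseqs (n^2 - n). Enc n k \<phi>1 \<phi>2 x \<in> BS n m (1/2))"
    using Enc_in_BS[OF assms(1,3) _ assms(4,5)] by blast
  \<comment> \<open>Ensures that the natural subtraction \<open>n^2 - n\<close> is not truncated, so
    the integer difference is \<open>n\<close>.\<close>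
  have "n \<le> n^2" by (simp add: power2_eq_square)
  then show "has_redundancy (n^2 - n) n (Enc n k \<phi>1 \<phi>2) (int n)"
    by (simp add: has_redundancy_def Enc_carrier of_nat_diff)
qed

end
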